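(* (1) Let $\phi$ be a formula built from variables and $\mathbf{0}$ using $\wedge,\vee,\rightarrow,\Box,\lozenge$. Then $\phi$ is valid in classical modal logic $\mathbf{K}$ iff ${\sim}{\sim}\phi$ is $\mathbf{K}\mathsf{biG}$-valid on all finitely branching crisp frames, iff ${\sim}{\sim}\phi$ is valid on all finitely branching fuzzy frames. (2) Let $\mathbb{F}$ be a class of (fuzzy or crisp) frames and $\mathsf{L}$ the set of formulas valid on every frame in $\mathbb{F}$. If $\{{\sim}{\sim}\phi:\phi\text{ is valid in }\mathbf{K}\text{ on every frame of }\mathbb{F}\}\subseteq\mathsf{L}$, then every frame in $\mathbb{F}$ is finitely branching.
   Context: Formulas: $\phi::=p\mid{\sim}\phi\mid\triangle\phi\mid\phi\wedge\phi\mid\phi\vee\phi\mid\phi\rightarrow\phi\mid\Box\phi\mid\lozenge\phi$, $\mathbf{1}:=p\rightarrow p$, $\mathbf{0}:={\sim}\mathbf{1}$. On $[0,1]$: $\wedge,\vee$ are $\min,\max$; $a\rightarrow b=1$ if $a\le b$ else $b$; ${\sim}a=1$ iff $a=0$ (else $0$); $\triangle a=1$ iff $a=1$ (else $0$). A fuzzy frame is $\langle W,R\rangle$ with $W\ne\varnothing$, $R:W\times W\to[0,1]$; a crisp frame has $R\subseteq W\times W$ (equivalently $R$ valued in $\{0,1\}$). A model adds $v:\mathtt{Prop}\times W\to[0,1]$ extended statewise on propositional connectives; on fuzzy frames $v(\Box\phi,w)=\inf_{w'\in W}(R(w,w')\rightarrow v(\phi,w'))$, $v(\lozenge\phi,w)=\sup_{w'\in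 W}\min(R(w,w'),v(\phi,w'))$; on crisp frames $v(\Box\phi,w)=\inf\{v(\phi,w'):wRw'\}$, $v(\lozenge\phi,w)=\sup\{v(\phi,w'):wRw'\}$ ($\inf\varnothing=1$, $\sup\varnothing=0$). A formula is valid on a frame iff $v(\phi,w)=1$ for all $v$ and $w$. A crisp frame is finitely branching iff $\{w':wRw'\}$ is finite for each $w$; a fuzzy frame iff $\{w':R(w,w')>0\}$ is finite for each $w$. Classical validity on a fuzzy frame refers to the crisp frame with relation $\{(w,w'):R(w,w')>0\}$. *)

theory Defs
  imports Complex_Main "HOL-Library.Infinite_Typeclass"
begin

datatype 'p fm =
    Var 'p
  | Neg "'p fm"
  | Delta "'p fm"
  | Conj "'p fm" "'p fm"
  | Disj "'p fm" "'p fm"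
  | Imp "'p fm" "'p fm"
  | Box "'p fm"
  | Dia "'p fm"

text \<open>The constants are abbreviated via a variable, whose choice is immaterial; it is kept as
  a parameter.\<close>

definition one :: "'p \<Rightarrow> 'p fm" where
  "one p = Imp (Var p) (Var p)"

definition zero :: "'p \<Rightarrow> 'p fm" where
  "zero p = Neg (one p)"

text \<open>Formulas over \<open>0, \<and>, \<or>, \<rightarrow>, \<box>, \<diamond>\<close>; negation occurs only inside the constant \<open>0\<close>.\<close>

inductive modal_fm :: "'p fm \<Rightarrow> bool" where
  "modal_fm (Var p)"
| "modal_fm (zero p)"
| "modal_fm \<phi> \<Longrightarrow> modal_fm \<psi> \<Longrightarrow> modal_fm (Conj \<phi> \<psi>)"
| "modal_fm \<phi> \<Longrightarrow> modal_fm \<psi> \<Longrightarrow> modal_fm (Disj \<phi> \<psi>)"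
| "modal_fm \<phi> \<Longrightarrow> modal_fm \<psi> \<Longrightarrow> modal_fm (Imp \<phi> \<psi>)"
| "modal_fm \<phi> \<Longrightarrow> modal_fm (Box \<phi>)"
| "modal_fm \<phi> \<Longrightarrow> modal_fm (Dia \<phi>)"

definition godel_neg :: "real \<Rightarrow> real" where
  "godel_neg a = (if a = 0 then 1 else 0)"

definition godel_delta :: "real \<Rightarrow> real" where
  "godel_delta a = (if a = 1 then 1 else 0)"

definition godel_imp :: "real \<Rightarrow> real \<Rightarrow> real" where
  "godel_imp a b = (if a \<le> b then 1 else b)"

text \<open>Infima and suprema in the complete lattice \<open>[0,1]\<close>; on \<^typ>\<open>real\<close> the values of
  \<^const>\<open>Inf\<close> and \<^const>\<open>Sup\<close> at the empty set are unsuitable.\<close>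

definition unit_Inf :: "real set \<Rightarrow> real" where
  "unit_Inf A = (if A = {} then 1 else Inf A)"

definition unit_Sup :: "real set \<Rightarrow> real" where
  "unit_Sup A = (if A = {} then 0 else Sup A)"

text \<open>The set of worlds is an explicit carrier inside the type \<^typ>\<open>'w\<close>; a fuzzy relation is
  relevant on the carrier only.\<close>

datatype 'w frame =
    is_crisp: Crisp (worlds: "'w set") "('w \<times> 'w) set"
  | is_fuzzy: Fuzzy (worlds: "'w set") "'w \<Rightarrow> 'w \<Rightarrow> real"

fun is_frame :: "'w frame \<Rightarrow> bool" where
  "is_frame (Crisp W R) \<longleftrightarrow> W \<noteq> {} \<and> R \<subseteq> W \<times> W"
| "is_frame (Fuzzy W R) \<longleftrightarrow> W \<noteq> {} \<and> (\<forall>w\<in>W. \<forall>w'\<in>W. 0 \<le> R w w' \<and> R w w' \<le> 1)"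

fun support :: "'w frame \<Rightarrow> ('w \<times> 'w) set" where
  "support (Crisp W R) = R"
| "support (Fuzzy W R) = {(w, w'). w \<in> W \<and> w' \<in> W \<and> R w w' > 0}"

definition finitely_branching :: "'w frame \<Rightarrow> bool" where
  "finitely_branching F \<longleftrightarrow> (\<forall>w\<in>worlds F. finite {w'. (w, w') \<in> support F})"

fun box_val :: "'w frame \<Rightarrow> ('w \<Rightarrow> real) \<Rightarrow> 'w \<Rightarrow> real" where
  "box_val (Crisp W R) f w = unit_Inf {f w' | w'. (w, w') \<in> R}"
| "box_val (Fuzzy W R) f w = unit_Inf {godel_imp (R w w') (f w') | w'. w' \<in> W}"

fun dia_val :: "'w frame \<Rightarrow> ('w \<Rightarrow> real) \<Rightarrow> 'w \<Rightarrow> real" where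
  "dia_val (Crisp W R) f w = unit_Sup {f w' | w'. (w, w') \<in> R}"
| "dia_val (Fuzzy W R) f w = unit_Sup {min (R w w') (f w') | w'. w' \<in> W}"

definition valuation :: "'w frame \<Rightarrow> ('p \<Rightarrow> 'w \<Rightarrow> real) \<Rightarrow> bool" where
  "valuation F v \<longleftrightarrow> (\<forall>p. \<forall>w\<in>worlds F. 0 \<le> v p w \<and> v p w \<le> 1)"

primrec val :: "'w frame \<Rightarrow> ('p \<Rightarrow> 'w \<Rightarrow> real) \<Rightarrow> 'p fm \<Rightarrow> 'w \<Rightarrow> real" where
  "val F v (Var p) = v p"
| "val F v (Neg \<phi>) = (\<lambda>w. godel_neg (val F v \<phi> w))"
| "val F v (Delta \<phi>) = (\<lambda>w. godel_delta (val F v \<phi> w))"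
| "val F v (Conj \<phi> \<psi>) = (\<lambda>w. min (val F v \<phi> w) (val F v \<psi> w))"
| "val F v (Disj \<phi> \<psi>) = (\<lambda>w. max (val F v \<phi> w) (val F v \<psi> w))"
| "val F v (Imp \<phi> \<psi>) = (\<lambda>w. godel_imp (val F v \<phi> w) (val F v \<psi> w))"
| "val F v (Box \<phi>) = box_val F (val F v \<phi>)"
| "val F v (Dia \<phi>) = dia_val F (val F v \<phi>)"

definition valid :: "'w frame \<Rightarrow> 'p fm \<Rightarrow> bool" where
  "valid F \<phi> \<longleftrightarrow> (\<forall>v. valuation F v \<longrightarrow> (\<forall>w\<in>worlds F. val F v \<phi> w = 1))"

definition logic_of :: "'w frame set \<Rightarrow> 'p fm set" where
  "logic_of \<FF> = {\<phi>. \<forall>F\<in>\<FF>. valid F \<phi>}"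

text \<open>Classical Kripke semantics over an accessibility relation. The operator \<^const>\<open>Delta\<close>,
  which does not belong to the classical language, is read as the identity, its restriction to
  the truth values 0 and 1.\<close>

primrec csat :: "('w \<times> 'w) set \<Rightarrow> ('p \<Rightarrow> 'w \<Rightarrow> bool) \<Rightarrow> 'w \<Rightarrow> 'p fm \<Rightarrow> bool" where
  "csat R V w (Var p) \<longleftrightarrow> V p w"
| "csat R V w (Neg \<phi>) \<longleftrightarrow> \<not> csat R V w \<phi>"
| "csat R V w (Delta \<phi>) \<longleftrightarrow> csat R V w \<phi>"
| "csat R V w (Conj \<phi> \<psi>) \<longleftrightarrow> csat R V w \<phi> \<and> csat R V w \<psi>"
| "csat R V w (Disj \<phi> \<psi>) \<longleftrightarrow> csat R V w \<phi> \<or> csat R V w \<psi>"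
| "csat R V w (Imp \<phi> \<psi>) \<longleftrightarrow> (csat R V w \<phi> \<longrightarrow> csat R V w \<psi>)"
| "csat R V w (Box \<phi>) \<longleftrightarrow> (\<forall>w'. (w, w') \<in> R \<longrightarrow> csat R V w' \<phi>)"
| "csat R V w (Dia \<phi>) \<longleftrightarrow> (\<exists>w'. (w, w') \<in> R \<and> csat R V w' \<phi>)"

definition classically_valid :: "'w frame \<Rightarrow> 'p fm \<Rightarrow> bool" where
  "classically_valid F \<phi> \<longleftrightarrow> (\<forall>V. \<forall>w\<in>worlds F. csat (support F) V w \<phi>)"

text \<open>Validity in \<open>K\<close>, for frames whose worlds are drawn from a given type.\<close>

definition K_valid :: "'w itself \<Rightarrow> 'p fm \<Rightarrow> bool" where
  "K_valid _ \<phi> \<longleftrightarrow>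
    (\<forall>F :: 'w frame. is_frame F \<longrightarrow> is_crisp F \<longrightarrow> classically_valid F \<phi>)"

end

theory Submission
  imports Defs
begin

text \<open>On a finitely branching frame the infima and suprema are taken over finitely many values, so
  \<open>a \<mapsto> [a > 0]\<close> is a homomorphism onto the two-element algebra that also commutes with the
  modalities; \<open>\<sim>\<sim>\<phi>\<close> is therefore valid iff \<open>\<phi>\<close> is classically valid on the underlying frame, and
  filtration lets finite models decide validity in \<open>K\<close>. If a world has infinitely many
  successors, giving \<open>p\<close> positive values tending to 0 along them makes the
  classically valid formula \<open>\<box>(p \<or> (p \<rightarrow> 0))\<close> take the value 0 there.\<close>

section \<open>Positivity of values on finitely branching frames\<close>

lemma unit_Inf_finite:
  assumes "finite A" "A \<subseteq> {0..1}"
  shows "unit_Inf A \<in> {0..1}" "0 < unit_Inf A \<longleftrightarrow> (\<forall>a\<in>A. 0 < a)"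
proof -
  \<comment> \<open>A finite nonempty set attains its infimum, so positivity of all members passes
    to it; for the empty set the default 1 matches vacuous truth.\<close>
  have "A \<noteq> {} \<Longrightarrow> Inf A = Min A" using assms(1) by (simp add: cInf_eq_Min)
  moreover have "A \<noteq> {} \<Longrightarrow> Min A \<in> {0..1}" using assms Min_in by blast
  ultimately show "unit_Inf A \<in> {0..1}" "0 < unit_Inf A \<longleftrightarrow> (\<forall>a\<in>A. 0 < a)"
    using assms(1) by (auto simp: unit_Inf_def)
qed

lemma unit_Sup_finite:
  assumes "finite A" "A \<subseteq> {0..1}"
  shows "unit_Sup A \<in> {0..1}" "0 < unit_Sup A \<longleftrightarrow> (\<exists>a\<in>A. 0 < a)"
proof -
  have "A \<noteq> {} \<Longrightarrow> Sup A = Max A" using assms(1) by (simp add: cSup_eq_Max)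
  moreover have "A \<noteq> {} \<Longrightarrow> Max A \<in> {0..1}" using assms Max_in by blast
  ultimately show "unit_Sup A \<in> {0..1}" "0 < unit_Sup A \<longleftrightarrow> (\<exists>a\<in>A. 0 < a)"
    using assms(1) by (auto simp: unit_Sup_def Max_gr_iff)
qed

lemma godel_imp_nonneg: "0 \<le> b \<Longrightarrow> 0 \<le> godel_imp a b"
  by (simp add: godel_imp_def)

lemma godel_imp_pos_iff:
  assumes "0 \<le> a" "0 \<le> b"
  shows "0 < godel_imp a b \<longleftrightarrow> (0 < a \<longrightarrow> 0 < b)"
  using assms by (auto simp: godel_imp_def)

lemma support_worlds:
  assumes "is_frame F" "(w, u) \<in> support F"
  shows "u \<in> worlds F"
  using assms by (cases F) auto

text \<open>In the fuzzy case the infimum ranges over all of \<open>W\<close>, which may be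
  infinite, but worlds outside the support have weight 0 and all contribute the value 1. Only
  finitely many distinct values remain.\<close>

lemma box_val_finite:
  assumes F: "is_frame F" and w: "w \<in> worlds F" and fin: "finite {u. (w, u) \<in> support F}"
    and f: "\<forall>u\<in>worlds F. f u \<in> {0..1}"
  shows "box_val F f w \<in> {0..1}"
    and "0 < box_val F f w \<longleftrightarrow> (\<forall>u. (w, u) \<in> support F \<longrightarrow> 0 < f u)"
proof -
  have "box_val F f w \<in> {0..1} \<and> (0 < box_val F f w \<longleftrightarrow> (\<forall>u. (w, u) \<in> support F \<longrightarrow> 0 < f u))"
  proof (cases F)
    case (Crisp W R)
    have A: "finite {f u | u. (w, u) \<in> R}" "{f u | u. (w, u) \<in> R} \<subseteq> {0..1}"
      using fin f F Crisp by auto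
    show ?thesis
      unfolding Crisp box_val.simps unit_Inf_finite(2)[OF A] using unit_Inf_finite(1)[OF A] by auto
  next
    case (Fuzzy W R)
    let ?A = "{godel_imp (R w u) (f u) | u. u \<in> W}"
    have "godel_imp (R w u) (f u) = 1" if "u \<in> W" "(w, u) \<notin> support F" for u
      using f F w Fuzzy that by (force simp: godel_imp_def)
    then have "?A \<subseteq> insert 1 ((\<lambda>u. godel_imp (R w u) (f u)) ` {u. (w, u) \<in> support F})"
      by blast
    then have A: "finite ?A" using fin by (meson finite.insertI finite_imageI finite_subset)
    have B: "?A \<subseteq> {0..1}" using f F Fuzzy by (auto simp: godel_imp_def)
    have R: "0 < godel_imp (R w u) (f u) \<longleftrightarrow> (0 < R w u \<longrightarrow> 0 < f u)" if "u \<in> W" for u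
      using F w f Fuzzy that by (intro godel_imp_pos_iff) auto
    show ?thesis
      unfolding Fuzzy box_val.simps unit_Inf_finite(2)[OF A B]
      using unit_Inf_finite(1)[OF A B] R w Fuzzy by auto
  qed
  then show "box_val F f w \<in> {0..1}"
    and "0 < box_val F f w \<longleftrightarrow> (\<forall>u. (w, u) \<in> support F \<longrightarrow> 0 < f u)" by auto
qed

text \<open>Dual to the box: worlds of weight 0 all contribute the value 0, so the supremum is the
  maximum of a finite set.\<close>

lemma dia_val_finite:
  assumes F: "is_frame F" and w: "w \<in> worlds F" and fin: "finite {u. (w, u) \<in> support F}"
    and f: "\<forall>u\<in>worlds F. f u \<in> {0..1}"
  shows "dia_val F f w \<in> {0..1}"
    and "0 < dia_val F f w \<longleftrightarrow> (\<exists>u. (w, u) \<in> support F \<and> 0 < f u)"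
proof -
  have "dia_val F f w \<in> {0..1} \<and> (0 < dia_val F f w \<longleftrightarrow> (\<exists>u. (w, u) \<in> support F \<and> 0 < f u))"
  proof (cases F)
    case (Crisp W R)
    have A: "finite {f u | u. (w, u) \<in> R}" "{f u | u. (w, u) \<in> R} \<subseteq> {0..1}"
      using fin f F Crisp by auto
    show ?thesis
      unfolding Crisp dia_val.simps unit_Sup_finite(2)[OF A] using unit_Sup_finite(1)[OF A] by auto
  next
    case (Fuzzy W R)
    let ?A = "{min (R w u) (f u) | u. u \<in> W}"
    have R: "0 \<le> R w u" "R w u \<le> 1" if "u \<in> W" for u
      using F w Fuzzy that by simp_all
    have fW: "0 \<le> f u" "f u \<le> 1" if "u \<in> W" for u
      using f Fuzzy that by simp_all
    have "min (R w u) (f u) = 0" if "u \<in> W" "(w, u) \<notin> support F" for u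
    proof -
      have "R w u = 0" using R(1) w Fuzzy that by force
      then show ?thesis using fW(1)[OF that(1)] by simp
    qed
    then have "?A \<subseteq> insert 0 ((\<lambda>u. min (R w u) (f u)) ` {u. (w, u) \<in> support F})"
      by blast
    then have A: "finite ?A" using fin by (meson finite.insertI finite_imageI finite_subset)
    have B: "?A \<subseteq> {0..1}" using R fW by (auto simp: min_le_iff_disj)
    show ?thesis
      unfolding Fuzzy dia_val.simps unit_Sup_finite(2)[OF A B]
      using unit_Sup_finite(1)[OF A B] w Fuzzy by auto
  qed
  then show "dia_val F f w \<in> {0..1}"
    and "0 < dia_val F f w \<longleftrightarrow> (\<exists>u. (w, u) \<in> support F \<and> 0 < f u)" by auto
qed

text \<open>Each connective of \<open>modal_fm\<close> commutes with positivity;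
  \<open>Delta\<close> would not, since it sends positive values below 1 to 0. The range claim is
  part of the same induction because the implication and modal cases use it for their
  arguments.\<close>

lemma val_pos_iff_csat:
  assumes F: "is_frame F" and fb: "finitely_branching F" and v: "valuation F v"
    and "modal_fm \<phi>" "w \<in> worlds F"
  shows "val F v \<phi> w \<in> {0..1} \<and>
    (0 < val F v \<phi> w \<longleftrightarrow> csat (support F) (\<lambda>p w. 0 < v p w) w \<phi>)"
  using assms(4,5)
proof (induction arbitrary: w rule: modal_fm.induct)
  case (1 p)
  then show ?case using v by (auto simp: valuation_def)
next
  case (2 p)
  then show ?case by (simp add: zero_def one_def godel_neg_def godel_imp_def)
next
  case (5 \<phi> \<psi>)
  then have "val F v \<phi> w \<in> {0..1}" "val F v \<psi> w \<in> {0..1}" by blast+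
  then show ?case using 5 by (simp add: godel_imp_pos_iff) (simp add: godel_imp_def)
next
  case (6 \<phi>)
  have fin: "finite {u. (w, u) \<in> support F}" using fb 6 by (auto simp: finitely_branching_def)
  have f: "\<forall>u\<in>worlds F. val F v \<phi> u \<in> {0..1}" using 6 by blast
  show ?case using box_val_finite[OF F 6(3) fin f] 6 support_worlds[OF F] by auto
next
  case (7 \<phi>)
  have fin: "finite {u. (w, u) \<in> support F}" using fb 7 by (auto simp: finitely_branching_def)
  have f: "\<forall>u\<in>worlds F. val F v \<phi> u \<in> {0..1}" using 7 by blast
  show ?case using dia_val_finite[OF F 7(3) fin f] 7 support_worlds[OF F] by auto
qed (auto simp: min_le_iff_disj le_max_iff_disj less_max_iff_disj)

text \<open>Double negation sends every positive value to 1 and fixes 0, so its validity says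
  exactly that all values of \<open>\<phi>\<close> are positive.\<close>

lemma valid_double_neg_iff:
  fixes F :: "'w frame" and \<phi> :: "'p fm"
  assumes F: "is_frame F" and fb: "finitely_branching F" and \<phi>: "modal_fm \<phi>"
  shows "valid F (Neg (Neg \<phi>)) \<longleftrightarrow> classically_valid F \<phi>"
proof
  assume valid: "valid F (Neg (Neg \<phi>))"
  show "classically_valid F \<phi>"
    unfolding classically_valid_def
  proof (intro allI ballI)
    fix V :: "'p \<Rightarrow> 'w \<Rightarrow> bool" and w assume w: "w \<in> worlds F"
    \<comment> \<open>Every classical valuation is the positivity pattern of its own 0/1-valued
      version.\<close>
    define v where "v = (\<lambda>p w. of_bool (V p w) :: real)"
    have v: "valuation F v" by (simp add: valuation_def v_def)
    have "val F v (Neg (Neg \<phi>)) w = 1" using valid v w unfolding valid_def by blast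
    then have "val F v \<phi> w \<noteq> 0" by (auto simp: godel_neg_def)
    then have "0 < val F v \<phi> w" using val_pos_iff_csat[OF F fb v \<phi> w] by force
    then show "csat (support F) V w \<phi>"
      using val_pos_iff_csat[OF F fb v \<phi> w] by (simp add: v_def)
  qed
next
  assume "classically_valid F \<phi>"
  then have "0 < val F v \<phi> w" if "valuation F v" "w \<in> worlds F" for v w
    using val_pos_iff_csat[OF F fb that(1) \<phi> that(2)] that(2) by (simp add: classically_valid_def)
  then show "valid F (Neg (Neg \<phi>))"
    by (fastforce simp: valid_def godel_neg_def)
qed

section \<open>Filtration and finite countermodels\<close>

primrec subformulas :: "'p fm \<Rightarrow> 'p fm set" where
  "subformulas (Var p) = {Var p}"
| "subformulas (Neg \<phi>) = insert (Neg \<phi>) (subformulas \<phi>)"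
| "subformulas (Delta \<phi>) = insert (Delta \<phi>) (subformulas \<phi>)"
| "subformulas (Conj \<phi> \<psi>) = insert (Conj \<phi> \<psi>) (subformulas \<phi> \<union> subformulas \<psi>)"
| "subformulas (Disj \<phi> \<psi>) = insert (Disj \<phi> \<psi>) (subformulas \<phi> \<union> subformulas \<psi>)"
| "subformulas (Imp \<phi> \<psi>) = insert (Imp \<phi> \<psi>) (subformulas \<phi> \<union> subformulas \<psi>)"
| "subformulas (Box \<phi>) = insert (Box \<phi>) (subformulas \<phi>)"
| "subformulas (Dia \<phi>) = insert (Dia \<phi>) (subformulas \<phi>)"

lemma finite_subformulas: "finite (subformulas \<phi>)"
  by (induction \<phi>) auto

text \<open>By hypothesis worlds with the same image agree on all subformulas, so the image of
  \<open>R\<close>, the smallest filtration, preserves truth. Using a map \<open>h\<close> instead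
  of equivalence classes lets the filtrated model live in any type.\<close>

lemma csat_filtration:
  assumes "\<And>u \<psi>. \<psi> \<in> subformulas \<phi> \<Longrightarrow> csat R V u \<psi> \<longleftrightarrow> h u \<in> T \<psi>"
  shows "csat (map_prod h h ` R) (\<lambda>p x. x \<in> T (Var p)) (h w) \<phi> \<longleftrightarrow> csat R V w \<phi>"
proof -
  have R': "(h w, x) \<in> map_prod h h ` R \<longleftrightarrow> (\<exists>u u'. (u, u') \<in> R \<and> h u = h w \<and> h u' = x)" for w x
    by force
  show ?thesis
    using assms
  proof (induction \<phi> arbitrary: w)
    case (Var p)
    from Var[of "Var p" w] show ?case by simp
  next
    case (Box \<phi>)
    have IH: "csat (map_prod h h ` R) (\<lambda>p x. x \<in> T (Var p)) (h w) \<phi> \<longleftrightarrow> csat R V w \<phi>" for w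
      by (rule Box.IH) (simp add: Box.prems)
    have T: "csat R V u (Box \<phi>) \<longleftrightarrow> h u \<in> T (Box \<phi>)" for u
      by (rule Box.prems) simp
    \<comment> \<open>From left to right, each \<open>u\<close> in the fibre of \<open>w\<close>
      satisfies \<open>Box \<phi>\<close> as well, by \<open>T\<close>; from right to left, take
      \<open>u = w\<close>.\<close>
    have "csat R V w (Box \<phi>) \<longleftrightarrow> (\<forall>u u'. (u, u') \<in> R \<and> h u = h w \<longrightarrow> csat R V u' \<phi>)"
      using T by (metis csat.simps(7))
    also have "\<dots> \<longleftrightarrow> csat (map_prod h h ` R) (\<lambda>p x. x \<in> T (Var p)) (h w) (Box \<phi>)"
      unfolding csat.simps R' using IH by metis
    finally show ?case ..
  next
    case (Dia \<phi>)
    have IH: "csat (map_prod h h ` R) (\<lambda>p x. x \<in> T (Var p)) (h w) \<phi> \<longleftrightarrow> csat R V w \<phi>" for w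
      by (rule Dia.IH) (simp add: Dia.prems)
    have T: "csat R V u (Dia \<phi>) \<longleftrightarrow> h u \<in> T (Dia \<phi>)" for u
      by (rule Dia.prems) simp
    have "csat R V w (Dia \<phi>) \<longleftrightarrow> (\<exists>u u'. (u, u') \<in> R \<and> h u = h w \<and> csat R V u' \<phi>)"
      using T by (metis csat.simps(8))
    also have "\<dots> \<longleftrightarrow> csat (map_prod h h ` R) (\<lambda>p x. x \<in> T (Var p)) (h w) (Dia \<phi>)"
      unfolding csat.simps R' using IH by metis
    finally show ?case ..
  qed simp_all
qed

text \<open>Worlds are identified when they satisfy the same subformulas. The finitely many classes
  are coded by elements of \<open>'x\<close>, which also transfers countermodels between world
  types.\<close>

lemma finite_countermodel:
  fixes R :: "('w \<times> 'w) set"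
  assumes "\<not> csat R V w \<phi>"
  obtains R' :: "('x::infinite \<times> 'x) set" and V' w'
  where "finite R'" "\<not> csat R' V' w' \<phi>"
proof -
  let ?S = "Pow (subformulas \<phi>)"
  have S: "finite ?S" by (simp add: finite_subformulas)
  obtain B :: "'x set" where "finite B" "card B = card ?S"
    using infinite_arbitrarily_large[OF infinite_UNIV] by metis
  then obtain g where g: "bij_betw g ?S B"
    using S by (metis finite_same_card_bij)
  define f where "f u = {\<psi> \<in> subformulas \<phi>. csat R V u \<psi>}" for u
  define h where "h u = g (f u)" for u
  have "range h \<subseteq> B" using g by (auto simp: h_def f_def bij_betw_def)
  then have "map_prod h h ` R \<subseteq> B \<times> B" by auto
  then have "finite (map_prod h h ` R)"
    using \<open>finite B\<close> by (meson finite_SigmaI finite_subset)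
  \<comment> \<open>The truth set of \<open>\<psi>\<close> is a union of fibres of \<open>h\<close>,
    since \<open>h u\<close> determines \<open>f u\<close>.\<close>
  moreover have "csat R V u \<psi> \<longleftrightarrow> h u \<in> h ` {u. csat R V u \<psi>}"
    if \<psi>: "\<psi> \<in> subformulas \<phi>" for u \<psi>
  proof
    assume "h u \<in> h ` {u. csat R V u \<psi>}"
    then obtain u' where u': "h u = h u'" "csat R V u' \<psi>" by blast
    have "inj_on g ?S" using g by (rule bij_betw_imp_inj_on)
    then have "f u = f u'" using u'(1) unfolding h_def by (rule inj_onD) (auto simp: f_def)
    then show "csat R V u \<psi>" using u'(2) \<psi> unfolding f_def by blast
  qed simp
  from csat_filtration[OF this, where w = w] assms
  have "\<not> csat (map_prod h h ` R) (\<lambda>p x. x \<in> h ` {u. csat R V u (Var p)}) (h w) \<phi>" by blast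
  ultimately show ?thesis by (rule that)
qed

section \<open>Validity in K through double negation\<close>

lemma K_valid_iff_csat:
  "K_valid TYPE('w) \<phi> \<longleftrightarrow> (\<forall>(R :: ('w \<times> 'w) set) V w. csat R V w \<phi>)"
proof
  assume K: "K_valid TYPE('w) \<phi>"
  show "\<forall>(R :: ('w \<times> 'w) set) V w. csat R V w \<phi>"
  proof (intro allI)
    fix R :: "('w \<times> 'w) set" and V w
    have "classically_valid (Crisp UNIV R) \<phi>"
      using K unfolding K_valid_def by simp
    then show "csat R V w \<phi>" by (simp add: classically_valid_def)
  qed
qed (simp add: K_valid_def classically_valid_def)

text \<open>The predicate \<open>C\<close> stands for crispness or fuzziness, so one proof serves
  both equivalences. Realising finite relations suffices because countermodels can be made finite,
  which also makes the frame finitely branching.\<close>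

lemma K_valid_iff_double_neg:
  fixes \<phi> :: "'p fm" and C :: "'b::infinite frame \<Rightarrow> bool"
  assumes \<phi>: "modal_fm \<phi>"
    and C: "\<And>R. finite R \<Longrightarrow>
      \<exists>F. is_frame F \<and> C F \<and> worlds F = UNIV \<and> support F = R"
  shows "K_valid TYPE('a::infinite) \<phi> \<longleftrightarrow>
    (\<forall>F. is_frame F \<and> C F \<and> finitely_branching F \<longrightarrow> valid F (Neg (Neg \<phi>)))"
proof
  assume K: "K_valid TYPE('a) \<phi>"
  have "csat R V w \<phi>" for R :: "('b \<times> 'b) set" and V w
  proof (rule ccontr)
    assume "\<not> csat R V w \<phi>"
    then obtain R' :: "('a \<times> 'a) set" and V' w' where "\<not> csat R' V' w' \<phi>"
      by (rule finite_countermodel)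
    then show False using K by (simp add: K_valid_iff_csat)
  qed
  then show "\<forall>F. is_frame F \<and> C F \<and> finitely_branching F \<longrightarrow> valid F (Neg (Neg \<phi>))"
    using \<phi> by (simp add: valid_double_neg_iff classically_valid_def)
next
  assume R: "\<forall>F. is_frame F \<and> C F \<and> finitely_branching F \<longrightarrow> valid F (Neg (Neg \<phi>))"
  show "K_valid TYPE('a) \<phi>"
    unfolding K_valid_iff_csat
  proof (intro allI, rule ccontr)
    fix R :: "('a \<times> 'a) set" and V w
    assume "\<not> csat R V w \<phi>"
    then obtain R' :: "('b \<times> 'b) set" and V' w' where R': "finite R'" "\<not> csat R' V' w' \<phi>"
      by (rule finite_countermodel)
    obtain F where F: "is_frame F" "C F" "worlds F = UNIV" "support F = R'"
      using C[OF R'(1)] by blast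
    have "{u. (w, u) \<in> R'} \<subseteq> snd ` R'" for w by force
    then have "finitely_branching F"
      using R'(1) F by (auto simp: finitely_branching_def intro: finite_subset)
    then show False
      using R F R'(2) valid_double_neg_iff[of F \<phi>] \<phi> by (auto simp: classically_valid_def)
  qed
qed

section \<open>Failure under infinite branching\<close>

lemma unit_Inf_nonneg: "(\<And>a. a \<in> A \<Longrightarrow> 0 \<le> a) \<Longrightarrow> 0 \<le> unit_Inf A"
  by (auto simp: unit_Inf_def intro: cInf_greatest)

lemma box_val_nonneg:
  assumes "is_frame F" "\<forall>u\<in>worlds F. 0 \<le> f u"
  shows "0 \<le> box_val F f w"
  using assms by (cases F) (auto intro!: unit_Inf_nonneg godel_imp_nonneg)

text \<open>An implication \<open>a \<rightarrow> b\<close> takes the value \<open>b\<close> once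
  \<open>b < a\<close>, so a successor bounds the box as soon as its value is below the weight of
  the edge. The threshold \<open>r\<close> does not depend on \<open>f\<close>, so a valuation can
  be built from it afterwards.\<close>

lemma box_val_le_successor:
  assumes F: "is_frame F" and wu: "(w, u) \<in> support F"
  shows "\<exists>r>0. r \<le> 1 \<and> (\<forall>f. (\<forall>u\<in>worlds F. 0 \<le> f u) \<longrightarrow> f u < r \<longrightarrow> box_val F f w \<le> f u)"
proof (cases F)
  case (Crisp W R)
  have "box_val F f w \<le> f u" if "\<forall>u\<in>worlds F. 0 \<le> f u" for f
  proof -
    have "bdd_below {f u | u. (w, u) \<in> R}"
      using that F Crisp by (intro bdd_belowI[of _ 0]) auto
    then show ?thesis using wu Crisp by (auto simp: unit_Inf_def intro!: cInf_lower)
  qed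
  \<comment> \<open>A crisp successor bounds the infimum whatever \<open>f u\<close> is, so the
    largest permitted threshold serves.\<close>
  then show ?thesis by (intro exI[of _ 1]) auto
next
  case (Fuzzy W R)
  have "box_val F f w \<le> f u" if "\<forall>u\<in>worlds F. 0 \<le> f u" "f u < R w u" for f
  proof -
    have "bdd_below {godel_imp (R w u) (f u) | u. u \<in> W}"
      using that F Fuzzy by (intro bdd_belowI[of _ 0]) (auto intro: godel_imp_nonneg)
    moreover have "f u = godel_imp (R w u) (f u)" using that by (simp add: godel_imp_def)
    ultimately show ?thesis using wu Fuzzy by (auto simp: unit_Inf_def intro!: cInf_lower)
  qed
  then show ?thesis using F wu Fuzzy by (intro exI[of _ "R w u"]) auto
qed

text \<open>Boxed excluded middle; the negation is an implication into \<open>zero p\<close> because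
  \<open>modal_fm\<close> admits \<open>Neg\<close> only inside that constant.\<close>

definition box_em :: "'p \<Rightarrow> 'p fm" where
  "box_em p = Box (Disj (Var p) (Imp (Var p) (zero p)))"

lemma modal_fm_box_em: "modal_fm (box_em p)"
  by (simp add: box_em_def modal_fm.intros)

lemma classically_valid_box_em: "classically_valid F (box_em p)"
  by (simp add: box_em_def classically_valid_def)

lemma box_em_refuted:
  fixes F :: "'w frame" and p :: 'p
  assumes F: "is_frame F" and nfb: "\<not> finitely_branching F"
  shows "\<not> valid F (Neg (Neg (box_em p)))"
proof -
  obtain w where w: "w \<in> worlds F" and inf: "infinite {u. (w, u) \<in> support F}"
    using nfb by (auto simp: finitely_branching_def)
  obtain g :: "nat \<Rightarrow> 'w" where g: "inj g" "range g \<subseteq> {u. (w, u) \<in> support F}"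
    using infinite_countable_subset[OF inf] by blast
  have "\<forall>n. \<exists>r>0. r \<le> 1 \<and>
      (\<forall>f. (\<forall>u\<in>worlds F. 0 \<le> f u) \<longrightarrow> f (g n) < r \<longrightarrow> box_val F f w \<le> f (g n))"
    using box_val_le_successor[OF F] g(2) by blast
  then obtain r where r: "\<And>n. 0 < r n" "\<And>n. r n \<le> 1"
      "\<And>n f. \<forall>u\<in>worlds F. 0 \<le> f u \<Longrightarrow> f (g n) < r n \<Longrightarrow> box_val F f w \<le> f (g n)"
    by metis
  \<comment> \<open>Halving puts \<open>e n\<close> strictly below the threshold; the second term
    forces the limit 0.\<close>
  define e where "e n = min (r n / 2) (inverse (real (Suc n)))" for n
  have e: "0 < e n" "e n \<le> 1" "e n < r n" "e n \<le> inverse (real (Suc n))" for n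
    using r(1,2)[of n] by (auto simp: e_def min_le_iff_disj min_less_iff_disj)
  \<comment> \<open>The value is positive at every world, so \<open>p \<rightarrow> 0\<close> is 0
    everywhere and excluded middle takes the value of \<open>p\<close> itself.\<close>
  define v :: "'p \<Rightarrow> 'w \<Rightarrow> real" where "v q u = (if u \<in> range g then e (inv g u) else 1)" for q u
  let ?f = "val F v (Disj (Var p) (Imp (Var p) (zero p)))"
  have v: "valuation F v" using e by (auto simp: valuation_def v_def less_imp_le)
  have f_eq: "?f u = v p u" for u
    using e(1) by (auto simp: v_def zero_def one_def godel_neg_def godel_imp_def not_le)
  have f: "\<forall>u\<in>worlds F. 0 \<le> ?f u" using v by (simp add: f_eq valuation_def del: val.simps)
  have fg: "?f (g n) = e n" for n using g(1) by (simp add: f_eq v_def del: val.simps)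
  have "box_val F ?f w \<le> inverse (real (Suc n))" for n
    using r(3)[OF f, of n] e[of n] fg[of n] by linarith
  \<comment> \<open>The infimum is 0 although no member of the sequence is.\<close>
  then have "box_val F ?f w \<le> 0"
    using reals_Archimedean[of "box_val F ?f w"] by (meson not_le)
  then have "box_val F ?f w = 0" using box_val_nonneg[OF F f] by (rule antisym)
  then have "val F v (Neg (Neg (box_em p))) w = 0"
    by (simp add: box_em_def godel_neg_def)
  then show ?thesis using v w unfolding valid_def by fastforce
qed

text \<open>An infinite world type has room for finite models of every size, so the types
  \<open>'a\<close>, \<open>'b\<close> and \<open>'c\<close> may differ. Restricting the second part
  to \<open>modal_fm\<close> weakens the assumed inclusion and so strengthens the claim.\<close>

theorem theorem8:
  shows "(\<forall>\<phi> :: 'p fm. modal_fm \<phi> \<longrightarrow>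
            (K_valid TYPE('a::infinite) \<phi> \<longleftrightarrow>
              (\<forall>F :: ('b::infinite) frame.
                 is_frame F \<and> is_crisp F \<and> finitely_branching F \<longrightarrow> valid F (Neg (Neg \<phi>)))) \<and>
            (K_valid TYPE('a) \<phi> \<longleftrightarrow>
              (\<forall>F :: ('c::infinite) frame.
                 is_frame F \<and> is_fuzzy F \<and> finitely_branching F \<longrightarrow> valid F (Neg (Neg \<phi>))))) \<and>
         (\<forall>\<FF> :: 'd frame set.
            (\<forall>F\<in>\<FF>. is_frame F) \<longrightarrow>
            {Neg (Neg \<phi>) | \<phi> :: 'p fm. modal_fm \<phi> \<and> (\<forall>F\<in>\<FF>. classically_valid F \<phi>)}
              \<subseteq> logic_of \<FF> \<longrightarrow>
            (\<forall>F\<in>\<FF>. finitely_branching F))"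
proof (intro conjI allI impI ballI)
  fix \<phi> :: "'p fm" assume \<phi>: "modal_fm \<phi>"
  have "\<exists>F :: 'b frame. is_frame F \<and> is_crisp F \<and> worlds F = UNIV \<and> support F = R" for R
    by (intro exI[of _ "Crisp UNIV R"]) simp
  then show "K_valid TYPE('a) \<phi> \<longleftrightarrow>
      (\<forall>F :: 'b frame. is_frame F \<and> is_crisp F \<and> finitely_branching F \<longrightarrow> valid F (Neg (Neg \<phi>)))"
    by (intro K_valid_iff_double_neg[OF \<phi>])
  have "\<exists>F :: 'c frame. is_frame F \<and> is_fuzzy F \<and> worlds F = UNIV \<and> support F = R" for R
    \<comment> \<open>With weights 0 and 1 the support is exactly \<open>R\<close>.\<close>
    by (intro exI[of _ "Fuzzy UNIV (\<lambda>w u. of_bool ((w, u) \<in> R))"]) simp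
  then show "K_valid TYPE('a) \<phi> \<longleftrightarrow>
      (\<forall>F :: 'c frame. is_frame F \<and> is_fuzzy F \<and> finitely_branching F \<longrightarrow> valid F (Neg (Neg \<phi>)))"
    by (intro K_valid_iff_double_neg[OF \<phi>])
next
  fix \<FF> :: "'d frame set" and F
  assume frames: "\<forall>F\<in>\<FF>. is_frame F" and F: "F \<in> \<FF>"
    and sub: "{Neg (Neg \<phi>) | \<phi> :: 'p fm. modal_fm \<phi> \<and> (\<forall>F\<in>\<FF>. classically_valid F \<phi>)}
      \<subseteq> logic_of \<FF>"
  \<comment> \<open>Here \<open>undefined\<close> just names some variable; any other would
    do.\<close>
  let ?\<phi> = "box_em undefined :: 'p fm"
  have "modal_fm ?\<phi> \<and> (\<forall>F\<in>\<FF>. classically_valid F ?\<phi>)"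
    by (simp add: modal_fm_box_em classically_valid_box_em)
  then have "Neg (Neg ?\<phi>) \<in> logic_of \<FF>"
    by (intro subsetD[OF sub] CollectI exI conjI) auto
  then have "valid F (Neg (Neg ?\<phi>))" using F by (simp add: logic_of_def)
  moreover have "is_frame F" using frames F by simp
  ultimately show "finitely_branching F" using box_em_refuted by metis
qed

end
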